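(* Let $(E,\pi,B)$ be a real vector bundle with $n$-dimensional fibres, $g$ a real bundle metric and $L$ a linear transport along paths in it. For each path $\gamma:J\to B$ fix bases of the fibres $\pi^{-1}(\gamma(s))$, $s\in J$, and let $F(s;\gamma)$ be a nondegenerate matrix function defining $L$, i.e. the matrix of $L$ in these bases is $H(t,s;\gamma)=F^{-1}(t;\gamma)F(s;\gamma)$. Then $L$ and $g$ are consistent (resp. consistent along a given path $\gamma$) if and only if for every (resp. for the given) path $\gamma:J\to B$ there exists a nondegenerate symmetric matrix $C(\gamma)=C(\gamma)^T$, depending only on $\gamma$ (not on $s$), such that $$\bigl(F^{-1}(s;\gamma)\bigr)^{T}G(\gamma(s))F^{-1}(s;\gamma)=C(\gamma),\qquad s\in J.$$
   Context: A path in $B$ is a (continuous) map $\gamma:J\to B$ with $J$ an arbitrary real interval. A real bundle metric $g$ assigns to each $x\in B$ a bilinear, symmetric, nondegenerate map $g_x:\pi^{-1}(x)\times\pi^{-1}(x)\to\mathbb{R}$ (no regularity in $x$ is needed). A linear transport along paths $L$ assigns to each path $\gamma:J\to B$ and $s,t\in J$ a linear map $L^\gamma_{s\to t}:\pi^{-1}(\gamma(s))\to\pi^{-1}(\gamma(t))$ with $L^\gamma_{t\to r}\circ L^\gamma_{s\to t}=L^\gamma_{s\to r}$ and $L^\gamma_{s\to s}=\mathrm{id}$ for all $r,s,t\in J$. $L$ and $g$ are consistent along $\gamma$ (locally consistent) if $g_{\gamma(s)}(u,v)=g_{\gamma(t)}(L^\gamma_{s\to t}u,L^\gamma_{s\to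 t}v)$ for all $s,t\in J$ and $u,v\in\pi^{-1}(\gamma(s))$; they are (globally) consistent if this holds along every path. Matrices: in bases $\{e_i(s)\}$ of $\pi^{-1}(\gamma(s))$, $H(t,s;\gamma)=[H^{i}_{\;j}(t,s;\gamma)]$ is defined by $L^\gamma_{s\to t}e_j(s)=\sum_i H^{i}_{\;j}(t,s;\gamma)e_i(t)$, and $G(\gamma(s))=[g_{\gamma(s)}(e_i(s),e_j(s))]_{ij}$. Every linear transport has a matrix of the form $H(t,s;\gamma)=F^{-1}(t;\gamma)F(s;\gamma)$ with $F(s;\gamma)$ invertible $n\times n$ matrices, $F$ being defined up to $F(s;\gamma)\mapsto A(\gamma)F(s;\gamma)$, $A(\gamma)$ invertible. *)

theory Defs
  imports
    "HOL-Analysis.Abstract_Euclidean_Space"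
    "Jordan_Normal_Form.VS_Connect"
    "Jordan_Normal_Form.Gauss_Jordan_Elimination"
begin

text \<open>
  A topological real vector bundle with total space \<open>TE\<close>, base \<open>TB\<close>, projection \<open>proj\<close> and
  \<open>n\<close>-dimensional fibres. The record \<open>V x\<close> carries the vector space operations of the fibre over
  \<open>x\<close>; its ring components \<open>mult\<close> and \<open>one\<close> are irrelevant. The field of scalars \<open>class_ring\<close> is
  the type \<^typ>\<open>real\<close> viewed as a record. \<open>Euclidean_space n\<close> consists of the
  real sequences that vanish from index \<open>n\<close> on, so \<open>n = 0\<close> is included.
\<close>

locale real_vector_bundle =
  fixes TE :: "'e topology" and TB :: "'b topology" and proj :: "'e \<Rightarrow> 'b"
    and V :: "'b \<Rightarrow> (real, 'e) module" and n :: nat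
  assumes continuous_proj: "continuous_map TE TB proj"
    and carrier_fibre:
      "x \<in> topspace TB \<Longrightarrow> carrier (V x) = {p \<in> topspace TE. proj p = x}"
    and vectorspace_fibre: "x \<in> topspace TB \<Longrightarrow> vectorspace class_ring (V x)"
    and fin_dim_fibre: "x \<in> topspace TB \<Longrightarrow> vectorspace.fin_dim class_ring (V x)"
    and dim_fibre: "x \<in> topspace TB \<Longrightarrow> vectorspace.dim class_ring (V x) = n"
    and locally_trivial:
      "x \<in> topspace TB \<Longrightarrow> \<exists>U \<phi>. openin TB U \<and> x \<in> U \<and>
         homeomorphic_map (prod_topology (subtopology TB U) (Euclidean_space n))
           (subtopology TE {p \<in> topspace TE. proj p \<in> U}) \<phi> \<and>
         (\<forall>y\<in>U. \<forall>u\<in>topspace (Euclidean_space n). proj (\<phi> (y, u)) = y) \<and>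
         (\<forall>y\<in>U. \<forall>u\<in>topspace (Euclidean_space n). \<forall>v\<in>topspace (Euclidean_space n).
            \<phi> (y, \<lambda>i. u i + v i) = \<phi> (y, u) \<oplus>\<^bsub>V y\<^esub> \<phi> (y, v)) \<and>
         (\<forall>y\<in>U. \<forall>a. \<forall>u\<in>topspace (Euclidean_space n).
            \<phi> (y, \<lambda>i. a * u i) = a \<odot>\<^bsub>V y\<^esub> \<phi> (y, u))"

text \<open>
  A path is a map defined on \<open>J\<close> only; it is represented by the function on \<^typ>\<open>real\<close> that is
  \<open>undefined\<close> outside \<open>J\<close>. Everything assigned to a path takes \<open>J\<close> and \<open>\<gamma>\<close> as arguments, because
  \<open>\<gamma>\<close> alone need not determine \<open>J\<close>.
\<close>

definition bundle_path :: "'b topology \<Rightarrow> real set \<Rightarrow> (real \<Rightarrow> 'b) \<Rightarrow> bool" where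
  "bundle_path TB J \<gamma> \<longleftrightarrow> is_interval J \<and> \<gamma> \<in> extensional J \<and>
     continuous_map (subtopology euclideanreal J) TB \<gamma>"

definition bundle_metric ::
  "'b topology \<Rightarrow> ('b \<Rightarrow> (real, 'e) module) \<Rightarrow> ('b \<Rightarrow> 'e \<Rightarrow> 'e \<Rightarrow> real) \<Rightarrow> bool" where
  "bundle_metric TB V g \<longleftrightarrow> (\<forall>x\<in>topspace TB.
     (\<forall>u\<in>carrier (V x). \<forall>v\<in>carrier (V x). \<forall>w\<in>carrier (V x).
        g x (u \<oplus>\<^bsub>V x\<^esub> v) w = g x u w + g x v w \<and>
        g x w (u \<oplus>\<^bsub>V x\<^esub> v) = g x w u + g x w v) \<and>
     (\<forall>a. \<forall>u\<in>carrier (V x). \<forall>v\<in>carrier (V x).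
        g x (a \<odot>\<^bsub>V x\<^esub> u) v = a * g x u v \<and>
        g x u (a \<odot>\<^bsub>V x\<^esub> v) = a * g x u v) \<and>
     (\<forall>u\<in>carrier (V x). \<forall>v\<in>carrier (V x). g x u v = g x v u) \<and>
     (\<forall>u\<in>carrier (V x). (\<forall>v\<in>carrier (V x). g x u v = 0) \<longrightarrow> u = \<zero>\<^bsub>V x\<^esub>))"

text \<open>\<open>L J \<gamma> s t\<close> is the transport from the fibre over \<open>\<gamma> s\<close> to the fibre over \<open>\<gamma> t\<close>.\<close>

definition linear_transport ::
  "'b topology \<Rightarrow> ('b \<Rightarrow> (real, 'e) module) \<Rightarrow>
   (real set \<Rightarrow> (real \<Rightarrow> 'b) \<Rightarrow> real \<Rightarrow> real \<Rightarrow> 'e \<Rightarrow> 'e) \<Rightarrow> bool" where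
  "linear_transport TB V L \<longleftrightarrow> (\<forall>J \<gamma>. bundle_path TB J \<gamma> \<longrightarrow>
     (\<forall>s\<in>J. \<forall>t\<in>J. linear_map class_ring (V (\<gamma> s)) (V (\<gamma> t)) (L J \<gamma> s t)) \<and>
     (\<forall>s\<in>J. \<forall>t\<in>J. \<forall>r\<in>J. \<forall>u\<in>carrier (V (\<gamma> s)).
        L J \<gamma> t r (L J \<gamma> s t u) = L J \<gamma> s r u) \<and>
     (\<forall>s\<in>J. \<forall>u\<in>carrier (V (\<gamma> s)). L J \<gamma> s s u = u))"

definition consistent_along ::
  "('b \<Rightarrow> (real, 'e) module) \<Rightarrow> ('b \<Rightarrow> 'e \<Rightarrow> 'e \<Rightarrow> real) \<Rightarrow>
   (real set \<Rightarrow> (real \<Rightarrow> 'b) \<Rightarrow> real \<Rightarrow> real \<Rightarrow> 'e \<Rightarrow> 'e) \<Rightarrow>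
   real set \<Rightarrow> (real \<Rightarrow> 'b) \<Rightarrow> bool" where
  "consistent_along V g L J \<gamma> \<longleftrightarrow>
     (\<forall>s\<in>J. \<forall>t\<in>J. \<forall>u\<in>carrier (V (\<gamma> s)). \<forall>v\<in>carrier (V (\<gamma> s)).
        g (\<gamma> s) u v = g (\<gamma> t) (L J \<gamma> s t u) (L J \<gamma> s t v))"

definition consistent ::
  "'b topology \<Rightarrow> ('b \<Rightarrow> (real, 'e) module) \<Rightarrow> ('b \<Rightarrow> 'e \<Rightarrow> 'e \<Rightarrow> real) \<Rightarrow>
   (real set \<Rightarrow> (real \<Rightarrow> 'b) \<Rightarrow> real \<Rightarrow> real \<Rightarrow> 'e \<Rightarrow> 'e) \<Rightarrow> bool" where
  "consistent TB V g L \<longleftrightarrow> (\<forall>J \<gamma>. bundle_path TB J \<gamma> \<longrightarrow> consistent_along V g L J \<gamma>)"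

definition ordered_basis :: "(real, 'e) module \<Rightarrow> nat \<Rightarrow> (nat \<Rightarrow> 'e) \<Rightarrow> bool" where
  "ordered_basis W n b \<longleftrightarrow> inj_on b {..<n} \<and> vectorspace.basis class_ring W (b ` {..<n})"

text \<open>
  \<open>H\<close> is the matrix of \<open>T\<close> with respect to the ordered bases \<open>b\<close> of the source and \<open>c\<close> of the
  target \<open>W\<close>: column \<open>j\<close> holds the coordinates of \<open>T (b j)\<close>.
\<close>

definition is_matrix_of ::
  "(real, 'e) module \<Rightarrow> nat \<Rightarrow> (nat \<Rightarrow> 'e) \<Rightarrow> (nat \<Rightarrow> 'e) \<Rightarrow> ('e \<Rightarrow> 'e) \<Rightarrow> real mat \<Rightarrow> bool" where
  "is_matrix_of W n b c T H \<longleftrightarrow> H \<in> carrier_mat n n \<and>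
     (\<forall>j<n. T (b j) = (\<Oplus>\<^bsub>W\<^esub>i\<in>{..<n}. H $$ (i, j) \<odot>\<^bsub>W\<^esub> c i))"

definition gram_matrix :: "nat \<Rightarrow> ('e \<Rightarrow> 'e \<Rightarrow> real) \<Rightarrow> (nat \<Rightarrow> 'e) \<Rightarrow> real mat" where
  "gram_matrix n h b = mat n n (\<lambda>(i, j). h (b i) (b j))"

text \<open>The inverse of an invertible matrix; unspecified otherwise.\<close>

definition mat_inv :: "real mat \<Rightarrow> real mat" where
  "mat_inv A = the (mat_inverse A)"

end

theory Submission
  imports Defs
begin

text \<open>
  A bilinear form is determined by its Gram matrix, and pulling it back along a linear map with
  matrix \<open>H\<close> turns the Gram matrix \<open>G\<close> into the congruent matrix \<open>H\<^sup>T G H\<close>. So consistency along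
  a path says \<open>G(s) = H(t,s)\<^sup>T G(t) H(t,s)\<close> for all \<open>s\<close>, \<open>t\<close>. With \<open>H(t,s) = F(t)\<^sup>-\<^sup>1 F(s)\<close> the two
  variables separate: \<open>(F(s)\<^sup>-\<^sup>1)\<^sup>T G(s) F(s)\<^sup>-\<^sup>1\<close> is the same matrix for all \<open>s\<close>, and it inherits
  symmetry and nondegeneracy from \<open>G(s)\<close>.
\<close>

section \<open>Congruence and inverses of square matrices\<close>

text \<open>Congruence is a right action of matrices on bilinear forms. This is what later allows a
  factor to be cancelled against its inverse.\<close>

lemma transpose_congruence_mult:
  fixes A B X :: "'a :: comm_semiring_1 mat"
  assumes A: "A \<in> carrier_mat n n" and B: "B \<in> carrier_mat n n" and X: "X \<in> carrier_mat n n"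
  shows "transpose_mat (B * A) * X * (B * A) =
    transpose_mat A * (transpose_mat B * X * B) * A"
proof -
  have tA: "transpose_mat A \<in> carrier_mat n n" and tB: "transpose_mat B \<in> carrier_mat n n"
    using A B by auto
  have "transpose_mat (B * A) * X * (B * A) = transpose_mat A * transpose_mat B * X * (B * A)"
    by (simp add: transpose_mult[OF B A])
  also have "\<dots> = transpose_mat A * transpose_mat B * X * B * A"
    using assoc_mult_mat[OF mult_carrier_mat[OF mult_carrier_mat[OF tA tB] X] B A] by simp
  also have "transpose_mat A * transpose_mat B * X = transpose_mat A * (transpose_mat B * X)"
    using assoc_mult_mat[OF tA tB X] .
  also have "\<dots> * B = transpose_mat A * (transpose_mat B * X * B)"
    using assoc_mult_mat[OF tA mult_carrier_mat[OF tB X] B] .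
  finally show ?thesis .
qed

text \<open>Brings a congruence into the double-sum shape in which a bilinear form expands on linear
  combinations.\<close>

lemma transpose_congruence_index:
  fixes H X :: "'a :: comm_semiring_1 mat"
  assumes H: "H \<in> carrier_mat n n" and X: "X \<in> carrier_mat n n" and "i < n" "j < n"
  shows "(transpose_mat H * X * H) $$ (i, j) =
    (\<Sum>k<n. \<Sum>l<n. H $$ (k, i) * H $$ (l, j) * X $$ (k, l))"
proof -
  have "(transpose_mat H * X * H) $$ (i, j) =
      (\<Sum>k<n. H $$ (k, i) * (\<Sum>l<n. X $$ (k, l) * H $$ (l, j)))"
    using assms by (auto simp: scalar_prod_def atLeast0LessThan intro!: sum.cong)
  also have "\<dots> = (\<Sum>k<n. \<Sum>l<n. H $$ (k, i) * H $$ (l, j) * X $$ (k, l))"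
    by (simp add: sum_distrib_left mult_ac)
  finally show ?thesis .
qed

lemma invertible_mat_if_det_nonzero:
  fixes A :: "'a :: field mat"
  assumes A: "A \<in> carrier_mat n n" and "det A \<noteq> 0"
  shows "invertible_mat A"
proof -
  obtain B where "B \<in> carrier_mat n n" "A * B = 1\<^sub>m n" "B * A = 1\<^sub>m n"
    \<comment> \<open>\<open>undefined\<close> only fills the extension slot of the record
      \<open>ring_mat\<close>; any value does.\<close>
    using det_non_zero_imp_unit[OF A \<open>det A \<noteq> 0\<close>, of undefined]
    by (auto simp: Units_def ring_mat_def)
  with A show ?thesis
    by (auto simp: invertible_mat_def inverts_mat_def intro!: exI[of _ B])
qed

text \<open>\<open>mat_inverse\<close> returns \<open>None\<close> only on non-units of the matrix
  ring, so an invertible matrix has to be recognised as a unit there before \<open>the\<close> can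
  be evaluated.\<close>

lemma mat_inv_inverse:
  assumes A: "A \<in> carrier_mat n n" and "invertible_mat A"
  shows "mat_inv A \<in> carrier_mat n n" "A * mat_inv A = 1\<^sub>m n" "mat_inv A * A = 1\<^sub>m n"
proof -
  obtain B where AB: "A * B = 1\<^sub>m n" and "B * A = 1\<^sub>m (dim_row B)"
    using assms by (auto simp: invertible_mat_def inverts_mat_def)
  \<comment> \<open>Invertibility does not fix the shape of \<open>B\<close>. The column counts of
    \<open>A * B\<close> and \<open>B * A\<close>, compared with those of the identities, force both
    dimensions of \<open>B\<close> to be \<open>n\<close>.\<close>
  have "dim_col (A * B) = n" "dim_col (B * A) = dim_row B"
    using AB \<open>B * A = 1\<^sub>m (dim_row B)\<close> by simp_all
  then have B: "B \<in> carrier_mat n n"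
    using A by auto
  with \<open>B * A = 1\<^sub>m (dim_row B)\<close> AB A have "A \<in> Units (ring_mat TYPE(real) n ())"
    by (auto simp: Units_def ring_mat_def)
  then obtain C where "mat_inverse A = Some C"
    using mat_inverse(1)[OF A, where b = "()"] by (cases "mat_inverse A") auto
  then show "mat_inv A \<in> carrier_mat n n" "A * mat_inv A = 1\<^sub>m n" "mat_inv A * A = 1\<^sub>m n"
    using mat_inverse(2)[OF A] by (auto simp: mat_inv_def)
qed

section \<open>Bilinear forms and coordinates in an ordered basis\<close>

lemma additive_functional_finsum:
  fixes W :: "(real, 'e) module" and \<phi> :: "'e \<Rightarrow> real"
  assumes W: "vectorspace class_ring W"
    and add: "\<And>u v. u \<in> carrier W \<Longrightarrow> v \<in> carrier W \<Longrightarrow> \<phi> (u \<oplus>\<^bsub>W\<^esub> v) = \<phi> u + \<phi> v"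
    and f: "f \<in> A \<rightarrow> carrier W" and "finite A"
  shows "\<phi> (\<Oplus>\<^bsub>W\<^esub>i\<in>A. f i) = (\<Sum>i\<in>A. \<phi> (f i))"
proof -
  interpret vectorspace class_ring W by (fact W)
  have zero: "\<phi> \<zero>\<^bsub>W\<^esub> = 0"
    using add[of "\<zero>\<^bsub>W\<^esub>" "\<zero>\<^bsub>W\<^esub>"] by simp
  from \<open>finite A\<close> f show ?thesis
  proof (induction A)
    case empty
    then show ?case by (simp add: zero)
  next
    case (insert a A)
    then have "f a \<in> carrier W" "f \<in> A \<rightarrow> carrier W" by auto
    with insert show ?case by (simp add: add M.finsum_closed)
  qed
qed

text \<open>The linearity clauses of \<open>bundle_metric\<close> on a single fibre, isolated so
  that they pass to pullbacks along linear maps; symmetry and nondegeneracy enter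
  separately.\<close>

definition bilinear_form :: "(real, 'e) module \<Rightarrow> ('e \<Rightarrow> 'e \<Rightarrow> real) \<Rightarrow> bool" where
  "bilinear_form W h \<longleftrightarrow>
     (\<forall>u\<in>carrier W. \<forall>v\<in>carrier W. \<forall>w\<in>carrier W.
        h (u \<oplus>\<^bsub>W\<^esub> v) w = h u w + h v w \<and> h w (u \<oplus>\<^bsub>W\<^esub> v) = h w u + h w v) \<and>
     (\<forall>a. \<forall>u\<in>carrier W. \<forall>v\<in>carrier W.
        h (a \<odot>\<^bsub>W\<^esub> u) v = a * h u v \<and> h u (a \<odot>\<^bsub>W\<^esub> v) = a * h u v)"

lemma bilinear_form_lincomb:
  fixes W :: "(real, 'e) module" and n :: nat
  assumes W: "vectorspace class_ring W" and h: "bilinear_form W h"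
    and b: "\<And>i. i < n \<Longrightarrow> b i \<in> carrier W"
  shows "h (\<Oplus>\<^bsub>W\<^esub>i\<in>{..<n}. x i \<odot>\<^bsub>W\<^esub> b i) (\<Oplus>\<^bsub>W\<^esub>i\<in>{..<n}. y i \<odot>\<^bsub>W\<^esub> b i) =
    (\<Sum>i<n. \<Sum>j<n. x i * y j * h (b i) (b j))"
proof -
  interpret vectorspace class_ring W by (fact W)
  have scaled: "(\<lambda>i. z i \<odot>\<^bsub>W\<^esub> b i) \<in> {..<n} \<rightarrow> carrier W" for z
    using b by auto
  have sum: "(\<Oplus>\<^bsub>W\<^esub>i\<in>{..<n}. z i \<odot>\<^bsub>W\<^esub> b i) \<in> carrier W" for z
    by (intro M.finsum_closed scaled)
  have left: "h (\<Oplus>\<^bsub>W\<^esub>i\<in>{..<n}. x i \<odot>\<^bsub>W\<^esub> b i) v = (\<Sum>i<n. x i * h (b i) v)"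
    if "v \<in> carrier W" for v
    using additive_functional_finsum[OF W _ scaled, of "\<lambda>u. h u v" x] h b that
    by (simp add: bilinear_form_def)
  have right: "h v (\<Oplus>\<^bsub>W\<^esub>i\<in>{..<n}. y i \<odot>\<^bsub>W\<^esub> b i) = (\<Sum>i<n. y i * h v (b i))"
    if "v \<in> carrier W" for v
    using additive_functional_finsum[OF W _ scaled, of "\<lambda>u. h v u" y] h b that
    by (simp add: bilinear_form_def)
  show ?thesis
    by (simp add: left[OF sum] right[OF b] sum_distrib_left mult.assoc)
qed

lemma ordered_basis_closed:
  assumes "vectorspace class_ring W" "ordered_basis W n b" "i < n"
  shows "b i \<in> carrier W"
  using assms by (auto simp: ordered_basis_def vectorspace.basis_def)

text \<open>\<open>lincomb\<close> attaches coefficients to vectors of a set, a matrix attaches them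
  to indices. Injectivity of \<open>b\<close> makes the two sums agree by reindexing.\<close>

lemma lincomb_image:
  fixes W :: "(real, 'e) module"
  assumes W: "vectorspace class_ring W" and b: "ordered_basis W n b"
  shows "module.lincomb W a (b ` {..<n}) = (\<Oplus>\<^bsub>W\<^esub>i\<in>{..<n}. a (b i) \<odot>\<^bsub>W\<^esub> b i)"
proof -
  interpret vectorspace class_ring W by (fact W)
  show ?thesis
    unfolding lincomb_def using b ordered_basis_closed[OF W b]
    by (subst M.finsum_reindex) (auto simp: ordered_basis_def)
qed

lemma ordered_basis_coordinates:
  assumes W: "vectorspace class_ring W" and b: "ordered_basis W n b" and u: "u \<in> carrier W"
  obtains x where "u = (\<Oplus>\<^bsub>W\<^esub>i\<in>{..<n}. x i \<odot>\<^bsub>W\<^esub> b i)"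
proof -
  interpret vectorspace class_ring W by (fact W)
  have "u \<in> span (b ` {..<n})" "b ` {..<n} \<subseteq> carrier W"
    using b u by (auto simp: ordered_basis_def basis_def)
  then obtain a where "lincomb a (b ` {..<n}) = u"
    using finite_in_span[of "b ` {..<n}" u] by auto
  then show thesis
    using that[of "a \<circ> b"] lincomb_image[OF W b] by simp
qed

lemma ordered_basis_independent:
  assumes W: "vectorspace class_ring W" and b: "ordered_basis W n b"
    and zero: "(\<Oplus>\<^bsub>W\<^esub>i\<in>{..<n}. x i \<odot>\<^bsub>W\<^esub> b i) = \<zero>\<^bsub>W\<^esub>" and "i < n"
  shows "x i = 0"
proof (rule ccontr)
  assume "x i \<noteq> 0"
  interpret vectorspace class_ring W by (fact W)
  have inj: "inj_on b {..<n}" using b by (simp add: ordered_basis_def)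
  \<comment> \<open>The dependence criterion wants coefficients on vectors, so \<open>x\<close> is
    carried from indices to basis vectors through the inverse of \<open>b\<close>.\<close>
  define a where "a = x \<circ> the_inv_into {..<n} b"
  have ab: "a (b j) = x j" if "j < n" for j
    using the_inv_into_f_f[OF inj] that by (simp add: a_def)
  have "lincomb a (b ` {..<n}) = (\<Oplus>\<^bsub>W\<^esub>i\<in>{..<n}. x i \<odot>\<^bsub>W\<^esub> b i)"
    unfolding lincomb_image[OF W b] using ab ordered_basis_closed[OF W b]
    by (intro M.finsum_cong') auto
  then have "lin_dep (b ` {..<n})"
    using zero \<open>x i \<noteq> 0\<close> \<open>i < n\<close> ab
    by (intro lin_dep_crit[of "b ` {..<n}" _ a "b i"]) auto
  then show False
    using b by (simp add: ordered_basis_def basis_def)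
qed

section \<open>Gram matrices\<close>

text \<open>Evaluation at basis vectors gives one direction, expansion of both arguments in
  coordinates the other. A condition on all pairs of vectors thus becomes a single matrix
  equation.\<close>

lemma bilinear_form_eq_iff_gram_matrix_eq:
  assumes W: "vectorspace class_ring W" and b: "ordered_basis W n b"
    and h: "bilinear_form W h" and k: "bilinear_form W k"
  shows "(\<forall>u\<in>carrier W. \<forall>v\<in>carrier W. h u v = k u v) \<longleftrightarrow> gram_matrix n h b = gram_matrix n k b"
proof
  assume "\<forall>u\<in>carrier W. \<forall>v\<in>carrier W. h u v = k u v"
  then show "gram_matrix n h b = gram_matrix n k b"
    using ordered_basis_closed[OF W b] by (auto simp: gram_matrix_def)
next
  assume eq: "gram_matrix n h b = gram_matrix n k b"
  have entry: "h (b i) (b j) = k (b i) (b j)" if "i < n" "j < n" for i j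
    using arg_cong[OF eq, of "\<lambda>A. A $$ (i, j)"] that by (simp add: gram_matrix_def)
  show "\<forall>u\<in>carrier W. \<forall>v\<in>carrier W. h u v = k u v"
  proof (intro ballI)
    fix u v assume "u \<in> carrier W" "v \<in> carrier W"
    then obtain x y where uv: "u = (\<Oplus>\<^bsub>W\<^esub>i\<in>{..<n}. x i \<odot>\<^bsub>W\<^esub> b i)"
      "v = (\<Oplus>\<^bsub>W\<^esub>i\<in>{..<n}. y i \<odot>\<^bsub>W\<^esub> b i)"
      using ordered_basis_coordinates[OF W b] by metis
    show "h u v = k u v"
      unfolding uv using ordered_basis_closed[OF W b]
      by (simp add: bilinear_form_lincomb[OF W h] bilinear_form_lincomb[OF W k] entry)
  qed
qed

lemma bilinear_form_pullback:
  assumes T: "linear_map class_ring W W' T" and h: "bilinear_form W' h"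
  shows "bilinear_form W (\<lambda>u v. h (T u) (T v))"
proof -
  interpret linear_map class_ring W W' T by (fact T)
  show ?thesis
    using h T_im by (simp add: bilinear_form_def)
qed

text \<open>The columns of \<open>H\<close> are the coordinates of the vectors
  \<open>T (b i)\<close> in the basis \<open>c\<close>, so expanding the form there produces the
  entries of the congruence.\<close>

lemma gram_matrix_pullback:
  assumes W: "vectorspace class_ring W" and c: "ordered_basis W n c"
    and h: "bilinear_form W h" and T: "is_matrix_of W n b c T H"
  shows "gram_matrix n (\<lambda>u v. h (T u) (T v)) b =
    transpose_mat H * gram_matrix n h c * H"
proof (rule eq_matI)
  have H: "H \<in> carrier_mat n n" and G: "gram_matrix n h c \<in> carrier_mat n n"
    using T by (auto simp: is_matrix_of_def gram_matrix_def)
  fix i j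
  assume "i < dim_row (transpose_mat H * gram_matrix n h c * H)"
    "j < dim_col (transpose_mat H * gram_matrix n h c * H)"
  then have ij: "i < n" "j < n" using H by auto
  have "h (T (b i)) (T (b j)) = (\<Sum>k<n. \<Sum>l<n. H $$ (k, i) * H $$ (l, j) * h (c k) (c l))"
    using T ij bilinear_form_lincomb[OF W h ordered_basis_closed[OF W c]]
    by (simp add: is_matrix_of_def)
  then show "gram_matrix n (\<lambda>u v. h (T u) (T v)) b $$ (i, j) =
      (transpose_mat H * gram_matrix n h c * H) $$ (i, j)"
    unfolding transpose_congruence_index[OF H G ij] using ij by (simp add: gram_matrix_def)
qed (use T in \<open>auto simp: is_matrix_of_def gram_matrix_def\<close>)

text \<open>A nonzero kernel vector of the Gram matrix would be the coordinate vector of a nonzero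
  \<open>u\<close> that is orthogonal to the whole space.\<close>

lemma det_gram_matrix_nonzero:
  assumes W: "vectorspace class_ring W" and b: "ordered_basis W n b" and h: "bilinear_form W h"
    and nondeg: "\<And>u. u \<in> carrier W \<Longrightarrow> (\<And>v. v \<in> carrier W \<Longrightarrow> h v u = 0) \<Longrightarrow> u = \<zero>\<^bsub>W\<^esub>"
  shows "det (gram_matrix n h b) \<noteq> 0"
proof
  interpret vectorspace class_ring W by (fact W)
  have G: "gram_matrix n h b \<in> carrier_mat n n" by (simp add: gram_matrix_def)
  assume "det (gram_matrix n h b) = 0"
  then obtain x where x: "x \<in> carrier_vec n" "x \<noteq> 0\<^sub>v n" "gram_matrix n h b *\<^sub>v x = 0\<^sub>v n"
    using det_0_iff_vec_prod_zero[OF G] by auto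
  \<comment> \<open>Row \<open>i\<close> of the kernel equation: in coordinates, \<open>b i\<close>
    is orthogonal to the vector \<open>u\<close> defined next.\<close>
  have row: "(\<Sum>j<n. x $ j * h (b i) (b j)) = 0" if "i < n" for i
    using arg_cong[OF x(3), of "\<lambda>v. v $ i"] that x(1)
    by (simp add: gram_matrix_def scalar_prod_def atLeast0LessThan mult.commute)
  define u where "u = (\<Oplus>\<^bsub>W\<^esub>i\<in>{..<n}. x $ i \<odot>\<^bsub>W\<^esub> b i)"
  have "u \<in> carrier W"
    unfolding u_def using ordered_basis_closed[OF W b] by (intro M.finsum_closed) auto
  moreover have "h v u = 0" if v_closed: "v \<in> carrier W" for v
  proof -
    obtain y where v: "v = (\<Oplus>\<^bsub>W\<^esub>i\<in>{..<n}. y i \<odot>\<^bsub>W\<^esub> b i)"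
      using ordered_basis_coordinates[OF W b v_closed] .
    have "h v u = (\<Sum>i<n. \<Sum>j<n. y i * x $ j * h (b i) (b j))"
      unfolding u_def v by (intro bilinear_form_lincomb[OF W h] ordered_basis_closed[OF W b])
    also have "\<dots> = (\<Sum>i<n. y i * (\<Sum>j<n. x $ j * h (b i) (b j)))"
      by (simp add: sum_distrib_left mult.assoc)
    finally show ?thesis by (simp add: row)
  qed
  ultimately have "u = \<zero>\<^bsub>W\<^esub>" by (rule nondeg)
  then have "x $ i = 0" if "i < n" for i
    using ordered_basis_independent[OF W b _ that] by (simp add: u_def)
  then have "x = 0\<^sub>v n" using x(1) by (intro eq_vecI) auto
  with x(2) show False ..
qed

section \<open>Separation of variables and consistency along a path\<close>

text \<open>Congruence by \<open>F\<^sub>1\<close> and congruence by its inverse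
  \<open>P\<^sub>1\<close> undo each other, so each equation yields the other. Index 1 will be the
  source parameter of the transport and index 2 the target; on the right each side involves only one
  of them.\<close>

lemma transpose_congruence_transport_iff:
  fixes F\<^sub>1 F\<^sub>2 P\<^sub>1 P\<^sub>2 X\<^sub>1 X\<^sub>2 :: "'a :: comm_ring_1 mat"
  assumes F: "F\<^sub>1 \<in> carrier_mat n n" and P: "P\<^sub>1 \<in> carrier_mat n n" "P\<^sub>2 \<in> carrier_mat n n"
    and X: "X\<^sub>1 \<in> carrier_mat n n" "X\<^sub>2 \<in> carrier_mat n n"
    and FP: "F\<^sub>1 * P\<^sub>1 = 1\<^sub>m n" and PF: "P\<^sub>1 * F\<^sub>1 = 1\<^sub>m n"
  shows "X\<^sub>1 = transpose_mat (P\<^sub>2 * F\<^sub>1) * X\<^sub>2 * (P\<^sub>2 * F\<^sub>1) \<longleftrightarrow>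
    transpose_mat P\<^sub>1 * X\<^sub>1 * P\<^sub>1 = transpose_mat P\<^sub>2 * X\<^sub>2 * P\<^sub>2"
proof -
  define Y where "Y = transpose_mat P\<^sub>2 * X\<^sub>2 * P\<^sub>2"
  have Y: "Y \<in> carrier_mat n n" using P X by (simp add: Y_def)
  \<comment> \<open>Read backwards, the composition law merges the nested congruences into one by
    \<open>F\<^sub>1 * P\<^sub>1\<close>, the identity; the next step does the same with
    \<open>P\<^sub>1 * F\<^sub>1\<close>.\<close>
  have "transpose_mat P\<^sub>1 * (transpose_mat F\<^sub>1 * Y * F\<^sub>1) * P\<^sub>1 = Y"
    using Y by (simp flip: transpose_congruence_mult[OF P(1) F Y] add: FP)
  moreover have "transpose_mat F\<^sub>1 * (transpose_mat P\<^sub>1 * X\<^sub>1 * P\<^sub>1) * F\<^sub>1 = X\<^sub>1"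
    using X by (simp flip: transpose_congruence_mult[OF F P(1) X(1)] add: PF)
  moreover have "transpose_mat (P\<^sub>2 * F\<^sub>1) * X\<^sub>2 * (P\<^sub>2 * F\<^sub>1) = transpose_mat F\<^sub>1 * Y * F\<^sub>1"
    unfolding Y_def by (rule transpose_congruence_mult[OF F P(2) X(2)])
  ultimately show ?thesis
    unfolding Y_def[symmetric] by metis
qed

text \<open>The whole argument for one path, with hypotheses on the fibres over that path only; the
  global claim results by quantifying over paths. Consistency amounts to constancy of the matrix
  \<open>M\<close> below, and its constant value is \<open>C\<close>.\<close>

lemma consistent_along_iff:
  fixes V :: "'b \<Rightarrow> (real, 'e) module" and F :: "real \<Rightarrow> real mat"
  assumes space: "\<And>s. s \<in> J \<Longrightarrow> vectorspace class_ring (V (\<gamma> s))"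
    and bilinear: "\<And>s. s \<in> J \<Longrightarrow> bilinear_form (V (\<gamma> s)) (g (\<gamma> s))"
    and symmetric: "\<And>s u v. s \<in> J \<Longrightarrow> u \<in> carrier (V (\<gamma> s)) \<Longrightarrow> v \<in> carrier (V (\<gamma> s)) \<Longrightarrow>
      g (\<gamma> s) u v = g (\<gamma> s) v u"
    and nondeg: "\<And>s u. s \<in> J \<Longrightarrow> u \<in> carrier (V (\<gamma> s)) \<Longrightarrow>
      (\<And>v. v \<in> carrier (V (\<gamma> s)) \<Longrightarrow> g (\<gamma> s) v u = 0) \<Longrightarrow> u = \<zero>\<^bsub>V (\<gamma> s)\<^esub>"
    and linear: "\<And>s t. s \<in> J \<Longrightarrow> t \<in> J \<Longrightarrow>
      linear_map class_ring (V (\<gamma> s)) (V (\<gamma> t)) (L J \<gamma> s t)"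
    and basis: "\<And>s. s \<in> J \<Longrightarrow> ordered_basis (V (\<gamma> s)) n (e s)"
    and F: "\<And>s. s \<in> J \<Longrightarrow> F s \<in> carrier_mat n n \<and> invertible_mat (F s)"
    and matrix: "\<And>s t. s \<in> J \<Longrightarrow> t \<in> J \<Longrightarrow>
      is_matrix_of (V (\<gamma> t)) n (e s) (e t) (L J \<gamma> s t) (mat_inv (F t) * F s)"
  shows "consistent_along V g L J \<gamma> \<longleftrightarrow>
    (\<exists>C \<in> carrier_mat n n. invertible_mat C \<and> C = transpose_mat C \<and>
      (\<forall>s\<in>J. transpose_mat (mat_inv (F s)) * gram_matrix n (g (\<gamma> s)) (e s) * mat_inv (F s) = C))"
proof -
  define G where "G s = gram_matrix n (g (\<gamma> s)) (e s)" for s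
  define P where "P s = mat_inv (F s)" for s
  \<comment> \<open>The columns of \<open>P s\<close> define a new basis of the fibre over
    \<open>\<gamma> s\<close>. The transport carries these bases into one another, since
    \<open>P t * F s * P s = P t\<close>, and \<open>M s\<close> is the Gram matrix of the metric in
    them.\<close>
  define M where "M s = transpose_mat (P s) * G s * P s" for s
  have G: "G s \<in> carrier_mat n n" for s
    by (simp add: G_def gram_matrix_def)
  have P: "P s \<in> carrier_mat n n" "F s * P s = 1\<^sub>m n" "P s * F s = 1\<^sub>m n" if "s \<in> J" for s
    using mat_inv_inverse[of "F s" n] F[OF that] by (auto simp: P_def)
  have "(\<forall>u\<in>carrier (V (\<gamma> s)). \<forall>v\<in>carrier (V (\<gamma> s)).
      g (\<gamma> s) u v = g (\<gamma> t) (L J \<gamma> s t u) (L J \<gamma> s t v)) \<longleftrightarrow> M s = M t"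
    if s: "s \<in> J" and t: "t \<in> J" for s t
  proof -
    have "(\<forall>u\<in>carrier (V (\<gamma> s)). \<forall>v\<in>carrier (V (\<gamma> s)).
      g (\<gamma> s) u v = g (\<gamma> t) (L J \<gamma> s t u) (L J \<gamma> s t v)) \<longleftrightarrow>
      G s = gram_matrix n (\<lambda>u v. g (\<gamma> t) (L J \<gamma> s t u) (L J \<gamma> s t v)) (e s)"
      unfolding G_def
      using bilinear_form_eq_iff_gram_matrix_eq[OF space[OF s] basis[OF s] bilinear[OF s]
          bilinear_form_pullback[OF linear[OF s t] bilinear[OF t]]] .
    also have "gram_matrix n (\<lambda>u v. g (\<gamma> t) (L J \<gamma> s t u) (L J \<gamma> s t v)) (e s) =
      transpose_mat (P t * F s) * G t * (P t * F s)"
      unfolding G_def P_def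
      using gram_matrix_pullback[OF space[OF t] basis[OF t] bilinear[OF t] matrix[OF s t]] .
    also have "G s = \<dots> \<longleftrightarrow> M s = M t"
      unfolding M_def
      using transpose_congruence_transport_iff[OF _ P(1)[OF s] P(1)[OF t] G G P(2,3)[OF s]] F[OF s]
      by blast
    finally show ?thesis .
  qed
  then have const_iff: "consistent_along V g L J \<gamma> \<longleftrightarrow> (\<forall>s\<in>J. \<forall>t\<in>J. M s = M t)"
    by (simp add: consistent_along_def)
  have M: "M s \<in> carrier_mat n n \<and> invertible_mat (M s) \<and> M s = transpose_mat (M s)"
    if s: "s \<in> J" for s
  proof (intro conjI)
    show carrier: "M s \<in> carrier_mat n n" using P(1)[OF s] G[of s] by (simp add: M_def)
    \<comment> \<open>\<open>det (P s)\<close> is a factor of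
      \<open>det (P s * F s) = 1\<close>.\<close>
    have "det (P s) \<noteq> 0"
      using det_mult[OF P(1)[OF s], of "F s"] F[OF s] P(3)[OF s] by auto
    moreover have "det (G s) \<noteq> 0"
      unfolding G_def
      using det_gram_matrix_nonzero[OF space[OF s] basis[OF s] bilinear[OF s] nondeg[OF s]] .
    ultimately have "det (M s) \<noteq> 0"
      using P(1)[OF s] G[of s] by (simp add: M_def det_mult[of _ n] det_transpose)
    then show "invertible_mat (M s)" by (rule invertible_mat_if_det_nonzero[OF carrier])
    have "transpose_mat (G s) = G s"
      using symmetric[OF s] ordered_basis_closed[OF space[OF s] basis[OF s]]
      by (auto simp: G_def gram_matrix_def)
    then show "M s = transpose_mat (M s)"
      using P(1)[OF s] G[of s]
      by (simp add: M_def transpose_mult[of _ n n _ n] assoc_mult_mat[of _ n n _ n _ n])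
  qed
  show ?thesis
  proof (cases "J = {}")
    case True
    \<comment> \<open>On the empty interval consistency is vacuous and no \<open>s\<close> supplies
      a matrix \<open>M s\<close>, so the identity serves as \<open>C\<close>.\<close>
    have "invertible_mat (1\<^sub>m n :: real mat)"
      by (rule invertible_mat_if_det_nonzero) auto
    with True show ?thesis
      by (auto simp: consistent_along_def intro!: bexI[of _ "1\<^sub>m n"])
  next
    case False
    \<comment> \<open>Any parameter \<open>r\<close> supplies the witness \<open>C = M r\<close>;
      conversely, a common value \<open>C\<close> makes \<open>M\<close> constant.\<close>
    then obtain r where "r \<in> J" by auto
    show ?thesis
      unfolding const_iff G_def[symmetric] P_def[symmetric] M_def[symmetric]
      using M[OF \<open>r \<in> J\<close>] \<open>r \<in> J\<close> by metis
  qed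
qed

theorem proposition2p2:
  fixes TE :: "'e topology" and TB :: "'b topology" and proj :: "'e \<Rightarrow> 'b"
    and V :: "'b \<Rightarrow> (real, 'e) module" and n :: nat
    and g :: "'b \<Rightarrow> 'e \<Rightarrow> 'e \<Rightarrow> real"
    and L :: "real set \<Rightarrow> (real \<Rightarrow> 'b) \<Rightarrow> real \<Rightarrow> real \<Rightarrow> 'e \<Rightarrow> 'e"
    and e :: "real set \<Rightarrow> (real \<Rightarrow> 'b) \<Rightarrow> real \<Rightarrow> nat \<Rightarrow> 'e"
    and F :: "real set \<Rightarrow> (real \<Rightarrow> 'b) \<Rightarrow> real \<Rightarrow> real mat"
  assumes vector_bundle: "real_vector_bundle TE TB proj V n"
    and metric: "bundle_metric TB V g"
    and transport: "linear_transport TB V L"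
    and bases: "\<And>J \<gamma> s. bundle_path TB J \<gamma> \<Longrightarrow> s \<in> J \<Longrightarrow>
      ordered_basis (V (\<gamma> s)) n (e J \<gamma> s)"
    and nondegenerate: "\<And>J \<gamma> s. bundle_path TB J \<gamma> \<Longrightarrow> s \<in> J \<Longrightarrow>
      F J \<gamma> s \<in> carrier_mat n n \<and> invertible_mat (F J \<gamma> s)"
    and matrix_of_L: "\<And>J \<gamma> s t. bundle_path TB J \<gamma> \<Longrightarrow> s \<in> J \<Longrightarrow> t \<in> J \<Longrightarrow>
      is_matrix_of (V (\<gamma> t)) n (e J \<gamma> s) (e J \<gamma> t) (L J \<gamma> s t)
        (mat_inv (F J \<gamma> t) * F J \<gamma> s)"
  shows "(consistent TB V g L \<longleftrightarrow>
      (\<forall>J \<gamma>. bundle_path TB J \<gamma> \<longrightarrow>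
        (\<exists>C \<in> carrier_mat n n. invertible_mat C \<and> C = transpose_mat C \<and>
          (\<forall>s\<in>J. transpose_mat (mat_inv (F J \<gamma> s)) * gram_matrix n (g (\<gamma> s)) (e J \<gamma> s)
                   * mat_inv (F J \<gamma> s) = C)))) \<and>
    (\<forall>J \<gamma>. bundle_path TB J \<gamma> \<longrightarrow>
      (consistent_along V g L J \<gamma> \<longleftrightarrow>
        (\<exists>C \<in> carrier_mat n n. invertible_mat C \<and> C = transpose_mat C \<and>
          (\<forall>s\<in>J. transpose_mat (mat_inv (F J \<gamma> s)) * gram_matrix n (g (\<gamma> s)) (e J \<gamma> s)
                   * mat_inv (F J \<gamma> s) = C))))"
proof -
  have along_iff: "consistent_along V g L J \<gamma> \<longleftrightarrow>
      (\<exists>C \<in> carrier_mat n n. invertible_mat C \<and> C = transpose_mat C \<and>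
        (\<forall>s\<in>J. transpose_mat (mat_inv (F J \<gamma> s)) * gram_matrix n (g (\<gamma> s)) (e J \<gamma> s)
                 * mat_inv (F J \<gamma> s) = C))" if path: "bundle_path TB J \<gamma>" for J \<gamma>
  proof (rule consistent_along_iff)
    fix s assume s: "s \<in> J"
    \<comment> \<open>Continuity places the values of the path in \<open>topspace TB\<close>, where
      the bundle and metric axioms hold.\<close>
    have x: "\<gamma> s \<in> topspace TB"
      using path s by (auto simp: bundle_path_def continuous_map_def)
    show "vectorspace class_ring (V (\<gamma> s))"
      using real_vector_bundle.vectorspace_fibre[OF vector_bundle x] .
    show "bilinear_form (V (\<gamma> s)) (g (\<gamma> s))"
      using metric x by (simp add: bundle_metric_def bilinear_form_def)
    show sym: "g (\<gamma> s) u v = g (\<gamma> s) v u"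
      if "u \<in> carrier (V (\<gamma> s))" "v \<in> carrier (V (\<gamma> s))" for u v
      using metric x that by (simp add: bundle_metric_def)
    show "u = \<zero>\<^bsub>V (\<gamma> s)\<^esub>" if u: "u \<in> carrier (V (\<gamma> s))"
      and "\<And>v. v \<in> carrier (V (\<gamma> s)) \<Longrightarrow> g (\<gamma> s) v u = 0" for u
      \<comment> \<open>\<open>bundle_metric\<close> states nondegeneracy with \<open>u\<close> in
        the first slot, here \<open>u\<close> stands in the second; symmetry exchanges them.\<close>
      using metric x u that(2) sym[OF u] by (simp add: bundle_metric_def)
    show "linear_map class_ring (V (\<gamma> s)) (V (\<gamma> t)) (L J \<gamma> s t)" if "t \<in> J" for t
      using transport path s that by (simp add: linear_transport_def)
  qed (use path bases nondegenerate matrix_of_L in auto)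
  then show ?thesis
    by (simp add: consistent_def along_iff)
qed

end
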